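(* Let $R$ be a ring and let $\mathcal{F}$ be an Oka family of (two-sided) ideals of $R$. If $I$ is an ideal of $R$ that is maximal (with respect to inclusion) among the ideals of $R$ not belonging to $\mathcal{F}$, then $I$ is a prime ideal. In other words, $\operatorname{Max}(\mathcal{F}') \subseteq \operatorname{Spec}(R)$.
   Context: Rings are associative and unital, not necessarily commutative; "ideal" means two-sided ideal. For a subset or element, $(a)$ is the two-sided ideal generated by $a$, and $(I,a) = I + (a)$. For ideals $I,J$ of $R$, $J^{-1}I = \{x\in R : Jx\subseteq I\}$ and $IJ^{-1} = \{x\in R : xJ\subseteq I\}$ (both are ideals). A family $\mathcal{F}$ of ideals of $R$ is an Oka family if $R\in\mathcal{F}$ and, for every ideal $I$ of $R$ and every $a\in R$, if $(I,a)$, $(a)^{-1}I$ and $I(a)^{-1}$ all belong to $\mathcal{F}$, then $I\in\mathcal{F}$. $\mathcal{F}'$ is the set of ideals of $R$ not in $\mathcal{F}$, $\operatorname{Max}(\mathcal{F}')$ is the set of maximal elements of $\mathcal{F}'$ under inclusion, and $\operatorname{Spec}(R)$ is the set of prime (two-sided) ideals of $R$. *)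

theory Defs
  imports "HOL-Algebra.Ideal_Product"
begin

text \<open>
  Rings are those of the locale \<^locale>\<open>ring\<close> (associative, unital, not necessarily commutative;
  the zero ring is allowed), and \<^locale>\<open>ideal\<close> is the library's two-sided ideal.
\<close>

text \<open>The ideal \<open>J\<inverse>I\<close>.\<close>

definition left_residual :: "('a, 'b) ring_scheme \<Rightarrow> 'a set \<Rightarrow> 'a set \<Rightarrow> 'a set"
  where "left_residual R J I = {x \<in> carrier R. \<forall>j \<in> J. j \<otimes>\<^bsub>R\<^esub> x \<in> I}"

text \<open>The ideal \<open>IJ\<inverse>\<close>.\<close>

definition right_residual :: "('a, 'b) ring_scheme \<Rightarrow> 'a set \<Rightarrow> 'a set \<Rightarrow> 'a set"
  where "right_residual R I J = {x \<in> carrier R. \<forall>j \<in> J. x \<otimes>\<^bsub>R\<^esub> j \<in> I}"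

definition oka_family :: "('a, 'b) ring_scheme \<Rightarrow> 'a set set \<Rightarrow> bool"
  where "oka_family R F \<longleftrightarrow>
    F \<subseteq> {I. ideal I R} \<and>
    carrier R \<in> F \<and>
    (\<forall>I a. ideal I R \<longrightarrow> a \<in> carrier R \<longrightarrow>
       I <+>\<^bsub>R\<^esub> (Idl\<^bsub>R\<^esub> {a}) \<in> F \<longrightarrow>
       left_residual R (Idl\<^bsub>R\<^esub> {a}) I \<in> F \<longrightarrow>
       right_residual R I (Idl\<^bsub>R\<^esub> {a}) \<in> F \<longrightarrow>
       I \<in> F)"

text \<open>
  The library's \<^locale>\<open>primeideal\<close> demands a commutative ring and is elementwise, so it is not
  the notion used over general rings. A prime ideal here is a proper ideal \<open>P\<close> such that
  \<open>A\<cdot>B \<subseteq> P\<close> implies \<open>A \<subseteq> P\<close> or \<open>B \<subseteq> P\<close> for all ideals \<open>A\<close>, \<open>B\<close>.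
\<close>

definition prime_two_sided_ideal :: "('a, 'b) ring_scheme \<Rightarrow> 'a set \<Rightarrow> bool"
  where "prime_two_sided_ideal R P \<longleftrightarrow>
    ideal P R \<and> P \<noteq> carrier R \<and>
    (\<forall>A B. ideal A R \<longrightarrow> ideal B R \<longrightarrow> A \<cdot>\<^bsub>R\<^esub> B \<subseteq> P \<longrightarrow> A \<subseteq> P \<or> B \<subseteq> P)"

definition prime_spectrum :: "('a, 'b) ring_scheme \<Rightarrow> 'a set set"
  where "prime_spectrum R = {P. prime_two_sided_ideal R P}"

text \<open>\<open>F'\<close>: only ideals are collected, not arbitrary subsets outside \<open>F\<close>.\<close>

definition ideal_complement :: "('a, 'b) ring_scheme \<Rightarrow> 'a set set \<Rightarrow> 'a set set"
  where "ideal_complement R F = {I. ideal I R \<and> I \<notin> F}"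

definition maximal_members :: "'a set set \<Rightarrow> 'a set set"
  where "maximal_members X = {I \<in> X. \<forall>J \<in> X. I \<subseteq> J \<longrightarrow> J = I}"

lemma (in ring) ideal_left_residual:
  assumes "ideal J R" "ideal I R"
  shows "ideal (left_residual R J I) R"
proof -
  interpret J: ideal J R by fact
  interpret I: ideal I R by fact
  show ?thesis
  proof (rule idealI)
    show "subgroup (left_residual R J I) (add_monoid R)"
      by (rule add.subgroupI)
        (auto simp: left_residual_def r_distr r_minus simp flip: a_inv_def)
  next
    fix a x assume a: "a \<in> left_residual R J I" and x: "x \<in> carrier R"
    show "x \<otimes> a \<in> left_residual R J I"
      using a x J.I_r_closed by (auto simp: left_residual_def simp flip: m_assoc)
    show "a \<otimes> x \<in> left_residual R J I"
      using a x I.I_r_closed by (auto simp: left_residual_def simp flip: m_assoc)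
  qed (rule ring_axioms)
qed

lemma (in ring) ideal_right_residual:
  assumes "ideal J R" "ideal I R"
  shows "ideal (right_residual R I J) R"
proof -
  interpret J: ideal J R by fact
  interpret I: ideal I R by fact
  show ?thesis
  proof (rule idealI)
    show "subgroup (right_residual R I J) (add_monoid R)"
      by (rule add.subgroupI)
        (auto simp: right_residual_def l_distr l_minus simp flip: a_inv_def)
  next
    fix a x assume a: "a \<in> right_residual R I J" and x: "x \<in> carrier R"
    show "x \<otimes> a \<in> right_residual R I J"
      using a x I.I_l_closed by (auto simp: right_residual_def m_assoc)
    show "a \<otimes> x \<in> right_residual R I J"
      using a x J.I_l_closed by (auto simp: right_residual_def m_assoc)
  qed (rule ring_axioms)
qed

text \<open>Over a commutative ring the notion of prime ideal agrees with the library's.\<close>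

lemma (in cring) prime_two_sided_ideal_iff_primeideal:
  "prime_two_sided_ideal R P \<longleftrightarrow> primeideal P R"
proof
  assume P: "prime_two_sided_ideal R P"
  then show "primeideal P R"
    by (auto simp: prime_two_sided_ideal_def intro!: divides_ideal_prod_imp_primeideal)
next
  assume P: "primeideal P R"
  then show "prime_two_sided_ideal R P"
    using primeideal_divides_ideal_prod primeideal.I_notcarr primeideal.axioms(1)
    unfolding prime_two_sided_ideal_def by metis
qed

end

theory Submission
  imports Defs
begin

text \<open>
  Let \<open>I\<close> be maximal outside the Oka family. If \<open>a, b \<notin> I\<close> and both \<open>(a)b\<close> and \<open>b(a)\<close> lie in \<open>I\<close>,
  then \<open>(I,a)\<close>, \<open>(a)\<inverse>I\<close> and \<open>I(a)\<inverse>\<close> are all strictly larger than \<open>I\<close>, so they lie in the family,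
  forcing \<open>I\<close> into it. Now suppose \<open>AB \<subseteq> I\<close> with neither factor inside \<open>I\<close>.
  The Oka property needs information on both sides, whereas \<open>BA\<close> is not known to lie in \<open>I\<close>.
  If \<open>A \<inter> B\<close> contains some \<open>c \<notin> I\<close>, take \<open>a = b = c\<close>, as \<open>(c)(c) \<subseteq> AB\<close>;
  otherwise \<open>BA \<subseteq> A \<inter> B \<subseteq> I\<close>, and any \<open>a \<in> A - I\<close>, \<open>b \<in> B - I\<close> will do.
\<close>

lemma (in ring) subset_left_residual:
  assumes "ideal I R" "J \<subseteq> carrier R"
  shows "I \<subseteq> left_residual R J I"
  using assms by (auto simp: left_residual_def intro: ideal.Icarr ideal.I_l_closed)

lemma (in ring) subset_right_residual:
  assumes "ideal I R" "J \<subseteq> carrier R"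
  shows "I \<subseteq> right_residual R I J"
  using assms by (auto simp: right_residual_def intro: ideal.Icarr ideal.I_r_closed)

lemma (in ring) oka_maximal_no_annihilating_pair:
  assumes oka: "oka_family R F"
    and I: "ideal I R" "I \<notin> F"
    and max: "\<And>J. ideal J R \<Longrightarrow> J \<notin> F \<Longrightarrow> I \<subseteq> J \<Longrightarrow> J = I"
    and a: "a \<in> carrier R" "a \<notin> I"
    and b: "b \<in> carrier R" "b \<notin> I"
    and left: "\<And>j. j \<in> Idl {a} \<Longrightarrow> j \<otimes> b \<in> I"
    and right: "\<And>j. j \<in> Idl {a} \<Longrightarrow> b \<otimes> j \<in> I"
  shows False
proof -
  let ?A = "Idl {a}"
  have A: "ideal ?A R" using a by (simp add: genideal_ideal)
  have sub: "?A \<subseteq> carrier R" using A by (auto dest: ideal.Icarr)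
  have larger: "J \<in> F" if "ideal J R" "I \<subseteq> J" "x \<in> J" "x \<notin> I" for J x
    using max[OF that(1) _ that(2)] that(3,4) by blast
  \<comment> \<open>The sum is the ideal generated by the union, so it contains both
    summands.\<close>
  have union: "I \<union> ?A \<subseteq> I <+> ?A"
    unfolding union_genideal[OF I(1) A, symmetric]
    using I(1) sub by (intro genideal_self Un_least) (auto dest: ideal.Icarr)
  have "I <+> ?A \<in> F"
    using larger[OF add_ideals[OF I(1) A]] union genideal_self'[OF a(1)] a(2) by blast
  \<comment> \<open>For both residuals, \<open>b\<close> is the element that makes the inclusion of
    \<open>I\<close> strict.\<close>
  moreover have "left_residual R ?A I \<in> F"
    using larger[OF ideal_left_residual[OF A I(1)] subset_left_residual[OF I(1) sub]] left b
    by (auto simp: left_residual_def)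
  moreover have "right_residual R I ?A \<in> F"
    using larger[OF ideal_right_residual[OF A I(1)] subset_right_residual[OF I(1) sub]] right b
    by (auto simp: right_residual_def)
  ultimately show False
    using oka I a(1) unfolding oka_family_def by blast
qed

lemma (in ring) oka_maximal_prime:
  assumes oka: "oka_family R F"
    and I: "ideal I R" "I \<notin> F"
    and max: "\<And>J. ideal J R \<Longrightarrow> J \<notin> F \<Longrightarrow> I \<subseteq> J \<Longrightarrow> J = I"
  shows "prime_two_sided_ideal R I"
  unfolding prime_two_sided_ideal_def
proof (intro conjI allI impI)
  \<comment> \<open>The unit ideal belongs to every Oka family.\<close>
  show "I \<noteq> carrier R" using oka I(2) unfolding oka_family_def by blast
next
  fix A B
  assume A: "ideal A R" and B: "ideal B R" and AB: "A \<cdot> B \<subseteq> I"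
  interpret A: ideal A R by fact
  interpret B: ideal B R by fact
  note no_pair = oka_maximal_no_annihilating_pair[OF oka I max]
  have prod: "x \<otimes> y \<in> I" if "x \<in> A" "y \<in> B" for x y
    using AB ideal_prod.prod[OF that] by blast
  have inter: "A \<inter> B \<subseteq> I"
  proof
    fix c assume c: "c \<in> A \<inter> B"
    then have "Idl {c} \<subseteq> A" "Idl {c} \<subseteq> B"
      using A B by (simp_all add: genideal_minimal)
    \<comment> \<open>Every \<open>j\<close> in \<open>Idl {c}\<close> lies in both ideals, as does
      \<open>c\<close>, so \<open>j \<otimes> c\<close> and \<open>c \<otimes> j\<close> are both
      products of an element of \<open>A\<close> by one of \<open>B\<close>.\<close>
    then show "c \<in> I"
      using no_pair[of c c] prod c A.Icarr by blast
  qed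
  show "A \<subseteq> I \<or> B \<subseteq> I"
  proof (rule ccontr)
    assume "\<not> (A \<subseteq> I \<or> B \<subseteq> I)"
    then obtain a b where a: "a \<in> A" "a \<notin> I" and b: "b \<in> B" "b \<notin> I" by blast
    have sub: "Idl {a} \<subseteq> A" using A a by (simp add: genideal_minimal)
    have "b \<otimes> j \<in> I" if "j \<in> Idl {a}" for j
    proof -
      have "j \<in> A" using sub that by blast
      then have "b \<otimes> j \<in> A \<inter> B"
        using b(1) A.I_l_closed B.I_r_closed A.Icarr B.Icarr by blast
      then show ?thesis using inter by blast
    qed
    \<comment> \<open>The products \<open>j \<otimes> b\<close> are covered by \<open>prod\<close>,
      since \<open>j\<close> lies in \<open>A\<close>.\<close>
    then show False
      using no_pair[of a b] sub prod a b A.Icarr B.Icarr by blast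
  qed
qed (rule I(1))

theorem theorem2p5:
  fixes R :: "('a, 'b) ring_scheme" and F :: "'a set set"
  assumes "ring R" and "oka_family R F"
  shows "(\<forall>I. ideal I R \<and> I \<notin> F \<and>
            (\<forall>J. ideal J R \<and> J \<notin> F \<and> I \<subseteq> J \<longrightarrow> J = I)
            \<longrightarrow> prime_two_sided_ideal R I)
       \<and> maximal_members (ideal_complement R F) \<subseteq> prime_spectrum R"
proof -
  have prime: "prime_two_sided_ideal R I"
    if "ideal I R" "I \<notin> F" "\<And>J. ideal J R \<Longrightarrow> J \<notin> F \<Longrightarrow> I \<subseteq> J \<Longrightarrow> J = I" for I
    using ring.oka_maximal_prime[OF assms that] .
  show ?thesis
  proof (intro conjI allI impI subsetI)
    fix I assume "ideal I R \<and> I \<notin> F \<and> (\<forall>J. ideal J R \<and> J \<notin> F \<and> I \<subseteq> J \<longrightarrow> J = I)"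
    then show "prime_two_sided_ideal R I" by (intro prime) simp_all
  next
    fix I assume "I \<in> maximal_members (ideal_complement R F)"
    then show "I \<in> prime_spectrum R"
      by (simp add: maximal_members_def ideal_complement_def prime_spectrum_def prime)
  qed
qed

end
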